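(* Let $F$ be a field and let $B$ be an associative unital $F$-algebra of finite dimension $n$ given by a multiplication table in a basis $e_1,\dots,e_n$ with $e_1=1$. Consider the following procedure. Step 1: for $i=2,\dots,n$, let $t_i\in F$ be the coefficient of $e_i$ in $e_i^2$ (expanded in the basis $e_1,\dots,e_n$), and let $n_i=e_i^2-t_ie_i$. If some $n_i\notin F$, return false. Step 2: for $i=2,\dots,n$ and $j=i+1,\dots,n$, let $n_{ij}=(e_i+e_j)^2-(t_i+t_j)(e_i+e_j)$. If some $n_{ij}\notin F$, return false. Otherwise, return true. Then this procedure returns true if and only if $B$ has a standard involution.
   Context: $F$ is identified with $F\cdot 1\subset B$. A standard involution on $B$ is an $F$-linear map $\overline{\phantom{x}}:B\to B$ with $\overline{1}=1$, $\overline{xy}=\overline{y}\,\overline{x}$ and $\overline{\overline{x}}=x$ for all $x,y\in B$, and such that $x\overline{x}\in F$ for all $x\in B$. A multiplication table for $B$ is the system $(c_{ijk})$ of elements of $F$ with $e_ie_j=\sum_k c_{ijk}e_k$. In the algorithmic setting, $F$ is a computable field (elements encoded in bits, with algorithms for the field operations and zero testing). *)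

theory Defs
  imports Complex_Main
begin

text \<open>An associative unital \<open>F\<close>-algebra: the type \<open>'b\<close> carries the ring structure,
  \<open>scl\<close> the scalar multiplication. (The locale \<open>algebra\<close> of HOL-Algebra is
  not usable here, since it requires a commutative multiplication.)\<close>

locale unital_algebra = vector_space scl
  for scl :: "'a::field \<Rightarrow> 'b::ring_1 \<Rightarrow> 'b" +
  assumes scl_mult_left: "scl a x * y = scl a (x * y)"
    and scl_mult_right: "x * scl a y = scl a (x * y)"

definition base_field :: "('a::field \<Rightarrow> 'b::ring_1 \<Rightarrow> 'b) \<Rightarrow> 'b set" where
  "base_field scl = range (\<lambda>a. scl a 1)"

definition standard_involution ::
    "('a::field \<Rightarrow> 'b::ring_1 \<Rightarrow> 'b) \<Rightarrow> ('b \<Rightarrow> 'b) \<Rightarrow> bool" where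
  "standard_involution scl \<sigma> \<longleftrightarrow>
     Vector_Spaces.linear scl scl \<sigma> \<and>
     \<sigma> 1 = 1 \<and>
     (\<forall>x y. \<sigma> (x * y) = \<sigma> y * \<sigma> x) \<and>
     (\<forall>x. \<sigma> (\<sigma> x) = x) \<and>
     (\<forall>x. x * \<sigma> x \<in> base_field scl)"

definition has_standard_involution :: "('a::field \<Rightarrow> 'b::ring_1 \<Rightarrow> 'b) \<Rightarrow> bool" where
  "has_standard_involution scl \<longleftrightarrow> (\<exists>\<sigma>. standard_involution scl \<sigma>)"

text \<open>Bases and tables are indexed by \<open>1, \<dots>, n\<close>; values at other indices are irrelevant.\<close>

definition indexed_basis ::
    "('a::field \<Rightarrow> 'b::ring_1 \<Rightarrow> 'b) \<Rightarrow> nat \<Rightarrow> (nat \<Rightarrow> 'b) \<Rightarrow> bool" where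
  "indexed_basis scl n e \<longleftrightarrow>
     inj_on e {1..n} \<and>
     \<not> module.dependent scl (e ` {1..n}) \<and>
     module.span scl (e ` {1..n}) = UNIV"

definition multiplication_table ::
    "('a::field \<Rightarrow> 'b::ring_1 \<Rightarrow> 'b) \<Rightarrow> nat \<Rightarrow> (nat \<Rightarrow> 'b) \<Rightarrow> (nat \<Rightarrow> nat \<Rightarrow> nat \<Rightarrow> 'a) \<Rightarrow> bool" where
  "multiplication_table scl n e c \<longleftrightarrow>
     (\<forall>i\<in>{1..n}. \<forall>j\<in>{1..n}. e i * e j = (\<Sum>k=1..n. scl (c i j k) (e k)))"

text \<open>The procedure sees only \<open>n\<close> and the table \<open>c\<close>. An element of the algebra is
  represented by its coordinates \<open>v 1, \<dots>, v n\<close>; \<open>elt\<close> gives the element represented.\<close>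

definition elt ::
    "('a::field \<Rightarrow> 'b::ring_1 \<Rightarrow> 'b) \<Rightarrow> nat \<Rightarrow> (nat \<Rightarrow> 'b) \<Rightarrow> (nat \<Rightarrow> 'a) \<Rightarrow> 'b" where
  "elt scl n e v = (\<Sum>k=1..n. scl (v k) (e k))"

definition unit_coords :: "nat \<Rightarrow> nat \<Rightarrow> 'a::field" where
  "unit_coords i = (\<lambda>k. if k = i then 1 else 0)"

definition add_coords :: "(nat \<Rightarrow> 'a::field) \<Rightarrow> (nat \<Rightarrow> 'a) \<Rightarrow> nat \<Rightarrow> 'a" where
  "add_coords u v = (\<lambda>k. u k + v k)"

definition diff_coords :: "(nat \<Rightarrow> 'a::field) \<Rightarrow> (nat \<Rightarrow> 'a) \<Rightarrow> nat \<Rightarrow> 'a" where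
  "diff_coords u v = (\<lambda>k. u k - v k)"

definition scale_coords :: "'a::field \<Rightarrow> (nat \<Rightarrow> 'a) \<Rightarrow> nat \<Rightarrow> 'a" where
  "scale_coords a v = (\<lambda>k. a * v k)"

definition mult_coords ::
    "nat \<Rightarrow> (nat \<Rightarrow> nat \<Rightarrow> nat \<Rightarrow> 'a::field) \<Rightarrow> (nat \<Rightarrow> 'a) \<Rightarrow> (nat \<Rightarrow> 'a) \<Rightarrow> nat \<Rightarrow> 'a" where
  "mult_coords n c u v = (\<lambda>k. \<Sum>i=1..n. \<Sum>j=1..n. u i * v j * c i j k)"

text \<open>Membership in \<open>F = F \<cdot> 1\<close> when the first basis vector is \<open>1\<close>, decided by zero
  testing; see \<open>elt_in_base_field_iff\<close> below.\<close>

definition in_base_field :: "nat \<Rightarrow> (nat \<Rightarrow> 'a::field) \<Rightarrow> bool" where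
  "in_base_field n v \<longleftrightarrow> list_all (\<lambda>k. v k = 0) [2..<Suc n]"

definition t_coeff :: "nat \<Rightarrow> (nat \<Rightarrow> nat \<Rightarrow> nat \<Rightarrow> 'a::field) \<Rightarrow> nat \<Rightarrow> 'a" where
  "t_coeff n c i = mult_coords n c (unit_coords i) (unit_coords i) i"

definition n_single :: "nat \<Rightarrow> (nat \<Rightarrow> nat \<Rightarrow> nat \<Rightarrow> 'a::field) \<Rightarrow> nat \<Rightarrow> nat \<Rightarrow> 'a" where
  "n_single n c i =
     diff_coords (mult_coords n c (unit_coords i) (unit_coords i))
       (scale_coords (t_coeff n c i) (unit_coords i))"

definition n_pair :: "nat \<Rightarrow> (nat \<Rightarrow> nat \<Rightarrow> nat \<Rightarrow> 'a::field) \<Rightarrow> nat \<Rightarrow> nat \<Rightarrow> nat \<Rightarrow> 'a" where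
  "n_pair n c i j =
     (let s = add_coords (unit_coords i) (unit_coords j)
      in diff_coords (mult_coords n c s s)
           (scale_coords (t_coeff n c i + t_coeff n c j) s))"

definition standard_involution_test ::
    "nat \<Rightarrow> (nat \<Rightarrow> nat \<Rightarrow> nat \<Rightarrow> 'a::field) \<Rightarrow> bool" where
  "standard_involution_test n c =
     (if list_ex (\<lambda>i. \<not> in_base_field n (n_single n c i)) [2..<Suc n] then False
      else if list_ex (\<lambda>i. list_ex (\<lambda>j. \<not> in_base_field n (n_pair n c i j)) [Suc i..<Suc n])
                [2..<Suc n] then False
      else True)"

text \<open>The coordinate operations represent the operations of the algebra.\<close>

context unital_algebra
begin

lemma elt_unit_coords:
  assumes "i \<in> {1..n}"
  shows "elt scl n e (unit_coords i) = e i"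
proof -
  have "elt scl n e (unit_coords i) = (\<Sum>k=1..n. if k = i then e k else 0)"
    unfolding elt_def unit_coords_def by (rule sum.cong) auto
  then show ?thesis using assms by simp
qed

lemma elt_add_coords: "elt scl n e (add_coords u v) = elt scl n e u + elt scl n e v"
  by (simp add: elt_def add_coords_def scale_left_distrib sum.distrib)

lemma elt_diff_coords: "elt scl n e (diff_coords u v) = elt scl n e u - elt scl n e v"
  by (simp add: elt_def diff_coords_def scale_left_diff_distrib sum_subtractf)

lemma elt_scale_coords: "elt scl n e (scale_coords a v) = scl a (elt scl n e v)"
  by (simp add: elt_def scale_coords_def scale_sum_right)

lemma elt_mult_coords:
  assumes "multiplication_table scl n e c"
  shows "elt scl n e (mult_coords n c u v) = elt scl n e u * elt scl n e v"
proof -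
  have "elt scl n e u * elt scl n e v
      = (\<Sum>i=1..n. \<Sum>j=1..n. scl (u i * v j) (e i * e j))"
    by (simp add: elt_def sum_product scl_mult_left scl_mult_right mult.commute)
  also have "\<dots> = (\<Sum>i=1..n. \<Sum>j=1..n. \<Sum>k=1..n. scl (u i * v j * c i j k) (e k))"
    using assms by (intro sum.cong refl)
      (simp add: multiplication_table_def scale_sum_right)
  also have "\<dots> = (\<Sum>i=1..n. \<Sum>k=1..n. \<Sum>j=1..n. scl (u i * v j * c i j k) (e k))"
    by (rule sum.cong[OF refl]) (rule sum.swap)
  also have "\<dots> = (\<Sum>k=1..n. \<Sum>i=1..n. \<Sum>j=1..n. scl (u i * v j * c i j k) (e k))"
    by (rule sum.swap)
  also have "\<dots> = elt scl n e (mult_coords n c u v)"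
    by (simp add: elt_def mult_coords_def scale_sum_left)
  finally show ?thesis by simp
qed

lemma elt_eq_iff:
  assumes "indexed_basis scl n e"
  shows "elt scl n e u = elt scl n e v \<longleftrightarrow> (\<forall>k\<in>{1..n}. u k = v k)"
proof
  assume eq: "elt scl n e u = elt scl n e v"
  have inj: "inj_on e {1..n}" and ind: "independent (e ` {1..n})"
    using assms by (auto simp: indexed_basis_def)
  define g where "g x = (let k = the_inv_into {1..n} e x in u k - v k)" for x
  have ge: "g (e k) = u k - v k" if "k \<in> {1..n}" for k
    using the_inv_into_f_f[OF inj that] by (simp add: g_def)
  have "(\<Sum>x\<in>e ` {1..n}. scl (g x) x) = (\<Sum>k=1..n. scl (u k - v k) (e k))"
    by (subst sum.reindex[OF inj]) (auto intro!: sum.cong simp: ge simp del: atLeastAtMost_iff)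
  also have "\<dots> = 0"
    using eq elt_diff_coords[of n e u v] by (simp add: elt_def diff_coords_def)
  finally have "\<forall>x\<in>e ` {1..n}. g x = 0"
    using ind by (auto simp: dependent_finite)
  then show "\<forall>k\<in>{1..n}. u k = v k" using ge by force
next
  assume "\<forall>k\<in>{1..n}. u k = v k"
  then show "elt scl n e u = elt scl n e v"
    unfolding elt_def by (intro sum.cong) auto
qed

lemma elt_in_base_field_iff:
  assumes "indexed_basis scl n e" and "1 \<le> n" and "e 1 = 1"
  shows "in_base_field n v \<longleftrightarrow> elt scl n e v \<in> base_field scl"
proof -
  have "elt scl n e v \<in> base_field scl \<longleftrightarrow>
      (\<exists>a. elt scl n e v = elt scl n e (scale_coords a (unit_coords 1)))"
    using elt_unit_coords[of 1 n e] assms(2,3)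
    by (auto simp: base_field_def elt_scale_coords)
  also have "\<dots> \<longleftrightarrow> (\<exists>a. \<forall>k\<in>{1..n}. v k = (if k = 1 then a else 0))"
    by (simp add: elt_eq_iff[OF assms(1)] scale_coords_def unit_coords_def if_distrib cong: if_cong)
  also have "\<dots> \<longleftrightarrow> (\<forall>k\<in>{2..n}. v k = 0)"
    by (force intro: exI[of _ "v 1"])
  finally show ?thesis
    by (auto simp: in_base_field_def list_all_iff)
qed

end

end

theory Submission
  imports Defs
begin

text \<open>For a standard involution \<open>\<sigma>\<close>, expanding \<open>(x + 1) \<sigma>(x + 1)\<close> shows that the trace
  \<open>x + \<sigma> x\<close> lies in \<open>F\<close>, so \<open>x\<^sup>2 = T x x - x \<sigma> x\<close> for the linear form \<open>T x = x + \<sigma> x\<close>; comparing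
  coefficients, \<open>T e\<^sub>i = t\<^sub>i\<close>. Conversely, let \<open>T\<close> be the linear form with \<open>T 1 = 2\<close> and
  \<open>T e\<^sub>i = t\<^sub>i\<close>. The two steps of the procedure say that the quadratic map \<open>x\<^sup>2 - T x x\<close> and its
  polar form take values in \<open>F\<close> on the basis, hence everywhere, and \<open>\<sigma> x = T x - x\<close> is then a
  standard involution. That \<open>\<sigma>\<close> reverses products amounts to \<open>polar x y = T (x y) - T x T y\<close>, which
  for \<open>x \<notin> F\<close> follows by computing \<open>x (x y) + (x y) x\<close> in two ways.\<close>

text \<open>For additive \<open>T\<close> this is \<open>Q (x + y) - Q x - Q y\<close> with
  \<open>Q x = x * x - T x * x\<close>. The form \<open>T\<close> takes its values in the algebra,
  as elements of F = F 1.\<close>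

definition polar :: "('b \<Rightarrow> 'b) \<Rightarrow> 'b \<Rightarrow> 'b \<Rightarrow> 'b::ring_1" where
  "polar T x y = x * y + y * x - T x * y - T y * x"

lemma polar_commute: "polar T x y = polar T y x"
  by (simp add: polar_def algebra_simps)

context unital_algebra
begin

section \<open>The scalars F inside the algebra\<close>

lemma subspace_base_field: "subspace (base_field scl)"
proof (rule subspaceI)
  show "0 \<in> base_field scl"
    unfolding base_field_def by (rule range_eqI[of _ _ 0]) simp
  show "x + y \<in> base_field scl" if "x \<in> base_field scl" "y \<in> base_field scl" for x y
    using that by (auto simp: base_field_def scale_left_distrib[symmetric])
  show "scl a x \<in> base_field scl" if "x \<in> base_field scl" for a x
    using that by (auto simp: base_field_def)
qed

lemmas base_field_add = subspace_add[OF subspace_base_field]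
  and base_field_diff = subspace_diff[OF subspace_base_field]
  and base_field_neg = subspace_neg[OF subspace_base_field]
  and base_field_scale = subspace_scale[OF subspace_base_field]

lemma scl_one_in_base_field: "scl a 1 \<in> base_field scl"
  by (simp add: base_field_def)

lemma one_in_base_field: "1 \<in> base_field scl"
  using scl_one_in_base_field[of 1] by simp

lemma base_field_mult:
  assumes "x \<in> base_field scl" "y \<in> base_field scl"
  shows "x * y \<in> base_field scl"
  using assms by (auto simp: base_field_def scl_mult_left)

lemma base_field_central:
  assumes "x \<in> base_field scl"
  shows "y * x = x * y"
  using assms by (auto simp: base_field_def scl_mult_left scl_mult_right)

text \<open>Nonzero scalars are invertible. Used in contrapositive form: if \<open>d\<close> is a
  scalar, \<open>d * x\<close> lies in F and \<open>x\<close> does not, then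
  \<open>d = 0\<close>.\<close>

lemma base_field_cancel:
  assumes "x \<in> base_field scl" "x \<noteq> 0" "x * y \<in> base_field scl"
  shows "y \<in> base_field scl"
proof -
  obtain a where a: "x = scl a 1"
    using assms(1) by (auto simp: base_field_def)
  with assms(2) have "y = scl (inverse a) (x * y)"
    by (auto simp: scl_mult_left)
  with base_field_scale[OF assms(3)] show ?thesis
    by metis
qed

section \<open>Standard involutions and trace forms\<close>

lemma standard_involution_trace:
  assumes "standard_involution scl \<sigma>"
  shows "x + \<sigma> x \<in> base_field scl"
proof -
  interpret \<sigma>: Vector_Spaces.linear scl scl \<sigma>
    using assms by (simp add: standard_involution_def)
  have "x + \<sigma> x = (x + 1) * \<sigma> (x + 1) - x * \<sigma> x - 1"
    using assms by (simp add: standard_involution_def \<sigma>.add algebra_simps)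
  also have "\<dots> \<in> base_field scl"
    using assms by (intro base_field_diff one_in_base_field) (auto simp: standard_involution_def)
  finally show ?thesis .
qed

text \<open>Moving the central trace to the right of \<open>x\<close> leaves
  \<open>- (x * \<sigma> x)\<close>, to which the axiom on \<open>\<sigma>\<close> applies as it
  stands.\<close>

lemma standard_involution_quadratic:
  assumes "standard_involution scl \<sigma>"
  shows "x * x - (x + \<sigma> x) * x \<in> base_field scl"
proof -
  have "x * x - (x + \<sigma> x) * x = x * x - x * (x + \<sigma> x)"
    using base_field_central[OF standard_involution_trace[OF assms], of x x] by simp
  also have "\<dots> = - (x * \<sigma> x)"
    by (simp add: algebra_simps)
  finally show ?thesis
    using assms base_field_neg by (auto simp: standard_involution_def)
qed

text \<open>By \<open>T 1 = 2\<close>, \<open>T\<close> doubles every scalar, which gives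
  involutivity in any characteristic. Expanding \<open>(T y - y) * (T x - x)\<close> turns the
  reversal of products into \<open>polar_eq\<close>, the only hard point.\<close>

lemma standard_involution_of_trace_form:
  assumes lin: "Vector_Spaces.linear scl scl T"
    and T: "\<And>x. T x \<in> base_field scl"
    and T1: "T 1 = 2"
    and quad: "\<And>x. x * x - T x * x \<in> base_field scl"
  shows "standard_involution scl (\<lambda>x. T x - x)"
proof -
  interpret T: Vector_Spaces.linear scl scl T by (rule lin)
  interpret vector_space_pair scl scl ..
  have TF: "T x = 2 * x" if "x \<in> base_field scl" for x
    using that T1 T.scale[of _ 1] scl_mult_right[of 2 _ 1] scl_mult_left[of _ 1]
    by (auto simp: base_field_def)
  have comm: "y * T x = T x * y" "y * (T x * z) = T x * (y * z)" for x y z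
    using base_field_central[OF T, of y x] by (simp_all add: mult.assoc[symmetric])
  have polar_F: "polar T x y \<in> base_field scl" for x y
  proof -
    have "polar T x y = ((x + y) * (x + y) - T (x + y) * (x + y))
        - (x * x - T x * x) - (y * y - T y * y)"
      by (simp add: polar_def T.add algebra_simps)
    then show ?thesis
      by (simp only:) (intro base_field_diff quad)
  qed
  have polar_eq: "polar T x y = T (x * y) - T x * T y" for x y
  \<comment> \<open>For x = a in F both sides equal - a T y. This case is separate because
    \<open>d * x\<close> being a scalar would then say nothing about \<open>d\<close>.\<close>
  proof (cases "x \<in> base_field scl")
    case True
    then obtain a where a: "x = scl a 1"
      by (auto simp: base_field_def)
    show ?thesis
      unfolding polar_def TF[OF True]
      by (simp add: a scl_mult_left scl_mult_right T.scale algebra_simps mult_2)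
  next
    case False
    \<comment> \<open>The scalar \<open>d\<close> is the defect of the claimed identity; the aim is
      to show that \<open>d * x\<close> is a scalar too.\<close>
    define d where "d = polar T x y + T x * T y - T (x * y)"
    define q where "q = x * x - T x * x"
    have q: "q \<in> base_field scl"
      unfolding q_def by (rule quad)
    have xx: "x * x = T x * x + q"
      by (simp add: q_def)
    have yx: "y * x = T x * y + T y * x + polar T x y - x * y"
      by (simp add: polar_def)
    \<comment> \<open>Reduce \<open>y * x\<close> by the polar form and then \<open>x * x\<close> by
      the quadratic relation.\<close>
    have "x * (y * x) = T x * (x * y) + T y * (x * x) + x * polar T x y - x * x * y"
      by (simp add: yx distrib_left right_diff_distrib comm(2)[of x] mult.assoc)
    also have "\<dots> = T x * T y * x + T y * q + polar T x y * x - q * y"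
      using base_field_central[OF polar_F, of x x y]
      by (simp add: xx distrib_left distrib_right comm(2)[of "T y" x] mult.assoc)
    finally have xyx: "x * (y * x) = T x * T y * x + T y * q + polar T x y * x - q * y" .
    have xxy: "x * (x * y) = T x * (x * y) + q * y"
      by (simp add: mult.assoc[symmetric] xx distrib_right)
    \<comment> \<open>The terms in \<open>x * y\<close> and in \<open>q * y\<close> cancel; what
      remains is linear in \<open>x\<close>, while the left side is a scalar by
      \<open>polar_F\<close>.\<close>
    have "polar T x (x * y) = d * x + T y * q"
      unfolding polar_def[of T x "x * y"]
      by (simp add: xyx xxy mult.assoc[of x y x] d_def algebra_simps)
    then have "d * x = polar T x (x * y) - T y * q"
      by simp
    also have "\<dots> \<in> base_field scl"
      by (intro base_field_diff polar_F base_field_mult T q)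
    finally have "d * x \<in> base_field scl" .
    moreover have "d \<in> base_field scl"
      unfolding d_def by (intro base_field_diff base_field_add polar_F base_field_mult T)
    ultimately have "d = 0"
      using False base_field_cancel by blast
    then show ?thesis
      by (simp add: d_def algebra_simps)
  qed
  show ?thesis
    unfolding standard_involution_def
  proof (intro conjI allI)
    show "Vector_Spaces.linear scl scl (\<lambda>x. T x - x)"
      using linear_compose_sub[OF lin linear_ident] .
    show "T 1 - 1 = 1"
      by (simp add: T1)
    show "T (x * y) - x * y = (T y - y) * (T x - x)" for x y
      using polar_eq[of x y] comm(1)[of y x] comm(1)[of "T y" x]
      by (simp add: polar_def algebra_simps)
    show "T (T x - x) - (T x - x) = x" for x
      by (simp add: T.diff TF[OF T] mult_2)
    show "x * (T x - x) \<in> base_field scl" for x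
      using base_field_neg[OF quad, of x] by (simp add: right_diff_distrib comm(1)[of x])
  qed
qed

section \<open>From a spanning set to the whole algebra\<close>

text \<open>The polar form is bilinear, so its values in F spread first. The quadratic map then
  follows, since it is additive up to the polar form and scales by squares.\<close>

lemma trace_form_of_basis:
  assumes basis: "span S = UNIV"
    and lin: "Vector_Spaces.linear scl scl T"
    and quad: "\<And>b. b \<in> S \<Longrightarrow> b * b - T b * b \<in> base_field scl"
    and polar: "\<And>b b'. \<lbrakk>b \<in> S; b' \<in> S; b \<noteq> b'\<rbrakk> \<Longrightarrow> polar T b b' \<in> base_field scl"
  shows "x * x - T x * x \<in> base_field scl"
proof -
  interpret T: Vector_Spaces.linear scl scl T by (rule lin)
  have sub: "subspace {x. polar T x y \<in> base_field scl}" for y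
  proof (rule subspaceI; simp only: mem_Collect_eq)
    show "polar T 0 y \<in> base_field scl"
      by (simp add: polar_def T.zero subspace_0[OF subspace_base_field])
    fix u v assume uv: "polar T u y \<in> base_field scl" "polar T v y \<in> base_field scl"
    have "polar T (u + v) y = polar T u y + polar T v y"
      by (simp add: polar_def T.add algebra_simps)
    with uv show "polar T (u + v) y \<in> base_field scl"
      by (simp add: base_field_add)
  next
    fix a u assume u: "polar T u y \<in> base_field scl"
    have "polar T (scl a u) y = scl a (polar T u y)"
      by (simp add: polar_def T.scale scl_mult_left scl_mult_right
          scale_right_distrib scale_right_diff_distrib)
    with u show "polar T (scl a u) y \<in> base_field scl"
      by (simp add: base_field_scale)
  qed
  have "polar T b b' \<in> base_field scl" if "b \<in> S" "b' \<in> S" for b b'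
  proof (cases "b = b'")
    case True
    \<comment> \<open>On the diagonal the polar form is twice the quadratic map.\<close>
    have "polar T b b = (b * b - T b * b) + (b * b - T b * b)"
      by (simp add: polar_def)
    with True quad[OF that(1)] show ?thesis
      by (simp add: base_field_add)
  qed (use that polar in blast)
  \<comment> \<open>Extend the first argument with the second fixed in \<open>S\<close>; symmetry
    then extends the second.\<close>
  then have "polar T x b \<in> base_field scl" if "b \<in> S" for x b
    using span_induct[OF _ sub[of b], of x S] that by (auto simp: basis)
  then have polar_F: "polar T x y \<in> base_field scl" for x y
    using span_induct[OF _ sub[of x], of y S] by (auto simp: basis polar_commute[of T _ x])
  have "subspace {x. x * x - T x * x \<in> base_field scl}"
  proof (rule subspaceI; simp only: mem_Collect_eq)
    show "0 * 0 - T 0 * 0 \<in> base_field scl"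
      by (simp add: subspace_0[OF subspace_base_field])
    fix u v
    assume uv: "u * u - T u * u \<in> base_field scl" "v * v - T v * v \<in> base_field scl"
    have "(u + v) * (u + v) - T (u + v) * (u + v)
        = (u * u - T u * u) + (v * v - T v * v) + polar T u v"
      by (simp add: polar_def T.add algebra_simps)
    with uv show "(u + v) * (u + v) - T (u + v) * (u + v) \<in> base_field scl"
      by (simp only:) (intro base_field_add polar_F)
  next
    fix a u assume u: "u * u - T u * u \<in> base_field scl"
    have "scl a u * scl a u - T (scl a u) * scl a u = scl (a * a) (u * u - T u * u)"
      by (simp add: T.scale scl_mult_left scl_mult_right scale_right_diff_distrib)
    with u show "scl a u * scl a u - T (scl a u) * scl a u \<in> base_field scl"
      by (simp only: base_field_scale)
  qed
  from span_induct[OF _ this, of x S] quad show ?thesis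
    by (auto simp: basis)
qed

section \<open>Correctness of the procedure\<close>

lemma standard_involution_test_iff:
  assumes "1 \<le> n" "indexed_basis scl n e" "e 1 = 1" "multiplication_table scl n e c"
  shows "standard_involution_test n c \<longleftrightarrow>
    (\<forall>i\<in>{2..n}. e i * e i - scl (t_coeff n c i) (e i) \<in> base_field scl) \<and>
    (\<forall>i\<in>{2..n}. \<forall>j\<in>{Suc i..n}. (e i + e j) * (e i + e j)
       - scl (t_coeff n c i + t_coeff n c j) (e i + e j) \<in> base_field scl)"
proof -
  have single: "in_base_field n (n_single n c i) \<longleftrightarrow>
      e i * e i - scl (t_coeff n c i) (e i) \<in> base_field scl" if "i \<in> {2..n}" for i
    using that by (simp add: elt_in_base_field_iff[OF assms(2,1,3)] n_single_def elt_diff_coords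
        elt_scale_coords elt_mult_coords[OF assms(4)] elt_unit_coords)
  have pair: "in_base_field n (n_pair n c i j) \<longleftrightarrow> (e i + e j) * (e i + e j)
       - scl (t_coeff n c i + t_coeff n c j) (e i + e j) \<in> base_field scl"
    if "i \<in> {2..n}" "j \<in> {Suc i..n}" for i j
    using that by (simp add: elt_in_base_field_iff[OF assms(2,1,3)] n_pair_def Let_def
        elt_diff_coords elt_add_coords elt_scale_coords elt_mult_coords[OF assms(4)] elt_unit_coords)
  have "standard_involution_test n c \<longleftrightarrow>
      (\<forall>i\<in>{2..n}. in_base_field n (n_single n c i)) \<and>
      (\<forall>i\<in>{2..n}. \<forall>j\<in>{Suc i..n}. in_base_field n (n_pair n c i j))"
    unfolding standard_involution_test_def list_ex_iff set_upt atLeastLessThanSuc_atLeastAtMost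
    by auto
  then show ?thesis
    using single pair by simp
qed

text \<open>The coefficient read off by the procedure is the only possible trace: \<open>e i\<close>
  and \<open>1 = e 1\<close> are distinct basis vectors, so the scalar part of
  \<open>e i * e i\<close> does not affect its \<open>i\<close>-th coordinate.\<close>

lemma t_coeff_eq:
  assumes "1 \<le> n" "indexed_basis scl n e" "e 1 = 1" "multiplication_table scl n e c"
    and i: "i \<in> {2..n}"
    and F: "e i * e i - scl a (e i) \<in> base_field scl"
  shows "t_coeff n c i = a"
proof -
  obtain b where "e i * e i - scl a (e i) = scl b 1"
    using F by (auto simp: base_field_def)
  then have "elt scl n e (mult_coords n c (unit_coords i) (unit_coords i)) =
      elt scl n e (add_coords (scale_coords a (unit_coords i)) (scale_coords b (unit_coords 1)))"
    using i assms(1,3)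
    by (simp add: elt_mult_coords[OF assms(4)] elt_add_coords elt_scale_coords elt_unit_coords
        algebra_simps)
  with i show ?thesis
    by (auto simp: elt_eq_iff[OF assms(2)] t_coeff_def add_coords_def scale_coords_def
        unit_coords_def)
qed

text \<open>Both steps test the quadratic relation of the involution, at \<open>e i\<close> and at
  \<open>e i + e j\<close>, whose traces are forced by \<open>t_coeff_eq\<close> and
  additivity.\<close>

lemma standard_involution_test_complete:
  assumes "1 \<le> n" "indexed_basis scl n e" "e 1 = 1" "multiplication_table scl n e c"
    and \<sigma>: "standard_involution scl \<sigma>"
  shows "standard_involution_test n c"
proof -
  interpret \<sigma>: Vector_Spaces.linear scl scl \<sigma>
    using \<sigma> by (simp add: standard_involution_def)
  have trace: "e i + \<sigma> (e i) = scl (t_coeff n c i) 1" if i: "i \<in> {2..n}" for i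
  proof -
    obtain a where a: "e i + \<sigma> (e i) = scl a 1"
      using standard_involution_trace[OF \<sigma>, of "e i"] by (auto simp: base_field_def)
    have "t_coeff n c i = a"
      using standard_involution_quadratic[OF \<sigma>, of "e i"]
      by (intro t_coeff_eq[OF assms(1-4) i]) (simp add: a scl_mult_left)
    with a show ?thesis by simp
  qed
  have pair: "(e i + e j) + \<sigma> (e i + e j) = scl (t_coeff n c i + t_coeff n c j) 1"
    if "i \<in> {2..n}" "j \<in> {2..n}" for i j
    using trace[OF that(1)] trace[OF that(2)]
    by (simp add: \<sigma>.add scale_left_distrib algebra_simps)
  show ?thesis
    unfolding standard_involution_test_iff[OF assms(1-4)]
  proof (intro conjI ballI)
    fix i assume i: "i \<in> {2..n}"
    show "e i * e i - scl (t_coeff n c i) (e i) \<in> base_field scl"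
      using standard_involution_quadratic[OF \<sigma>, of "e i"] by (simp add: trace[OF i] scl_mult_left)
    fix j assume j: "j \<in> {Suc i..n}"
    with i have "j \<in> {2..n}" by simp
    show "(e i + e j) * (e i + e j) - scl (t_coeff n c i + t_coeff n c j) (e i + e j)
        \<in> base_field scl"
      using standard_involution_quadratic[OF \<sigma>, of "e i + e j"]
      unfolding pair[OF i \<open>j \<in> {2..n}\<close>] by (simp add: scl_mult_left)
  qed
qed

lemma standard_involution_test_sound:
  assumes "1 \<le> n" "indexed_basis scl n e" "e 1 = 1" "multiplication_table scl n e c"
    and test: "standard_involution_test n c"
  shows "has_standard_involution scl"
proof -
  let ?S = "e ` {1..n}"
  have inj: "inj_on e {1..n}" and ind: "independent ?S" and span: "span ?S = UNIV"
    using assms(2) by (auto simp: indexed_basis_def)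
  interpret vector_space_pair scl scl ..
  \<comment> \<open>The procedure computes no trace for the index 1; the trace of the unit has to be
    2.\<close>
  define s where "s i = (if i = 1 then 2 else t_coeff n c i)" for i :: nat
  obtain T where lin: "Vector_Spaces.linear scl scl T"
    and T_basis: "\<forall>b\<in>?S. T b = scl (s (the_inv_into {1..n} e b)) 1"
    using linear_independent_extend[OF ind, of "\<lambda>b. scl (s (the_inv_into {1..n} e b)) 1"]
    by (elim exE conjE) (rule that)
  interpret T: Vector_Spaces.linear scl scl T by (rule lin)
  have Te: "T (e i) = scl (s i) 1" if "i \<in> {1..n}" for i
    using T_basis the_inv_into_f_f[OF inj that] that by auto
  have two: "scl 2 1 = (2 :: 'b)"
    by (metis one_add_one scale_left_distrib scale_one)
  have T1: "T 1 = 2"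
    using Te[of 1] assms(1,3) by (simp add: s_def two)
  have quad: "e i * e i - T (e i) * e i \<in> base_field scl" if i: "i \<in> {1..n}" for i
  proof (cases "i = 1")
    \<comment> \<open>The untested index 1: the quadratic map sends 1 to 1 - 2 = -1.\<close>
    case True
    show ?thesis
      unfolding True assms(3) T1 using base_field_neg[OF one_in_base_field] by simp
  next
    case False
    with i test show ?thesis
      by (auto simp: standard_involution_test_iff[OF assms(1-4)] Te scl_mult_left s_def)
  qed
  have T_F: "T x \<in> base_field scl" for x
  proof -
    have "T x \<in> base_field scl" if "x \<in> span ?S"
      using that
    proof (induction rule: span_induct_alt)
      case base
      then show ?case by (simp add: T.zero subspace_0[OF subspace_base_field])
    next
      case (step a b y)
      then show ?case
        using Te by (auto simp: T.add T.scale intro!: base_field_add base_field_scale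
            scl_one_in_base_field simp del: scale_scale)
    qed
    then show ?thesis unfolding span by simp
  qed
  have polar_less: "polar T (e i) (e j) \<in> base_field scl"
    if "i \<in> {1..n}" "j \<in> {1..n}" "i < j" for i j
  proof (cases "i = 1")
    case True
    \<comment> \<open>Pairs with the unit are not tested either, but there \<open>T 1 = 2\<close>
      cancels \<open>e j + e j\<close>.\<close>
    have "polar T (e i) (e j) = - T (e j)"
      unfolding True assms(3) by (simp add: polar_def T1 mult_2)
    then show ?thesis
      by (simp add: base_field_neg T_F)
  next
    case False
    with that have i: "i \<in> {2..n}" and j: "j \<in> {Suc i..n}"
      by auto
    \<comment> \<open>Polarization: the element tested in step 2 minus the two tested in step
      1.\<close>
    have "polar T (e i) (e j) =
        ((e i + e j) * (e i + e j) - scl (t_coeff n c i + t_coeff n c j) (e i + e j))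
        - (e i * e i - T (e i) * e i) - (e j * e j - T (e j) * e j)"
      using that False
      by (simp add: polar_def Te s_def scl_mult_left scale_left_distrib scale_right_distrib
          algebra_simps)
    moreover have "(e i + e j) * (e i + e j)
        - scl (t_coeff n c i + t_coeff n c j) (e i + e j) \<in> base_field scl"
      using test i j unfolding standard_involution_test_iff[OF assms(1-4)] by blast
    ultimately show ?thesis
      using quad[OF that(1)] quad[OF that(2)] by (simp only: base_field_diff)
  qed
  \<comment> \<open>Only i < j is tested; symmetry of the polar form supplies the other
    order.\<close>
  have polar: "polar T (e i) (e j) \<in> base_field scl"
    if "i \<in> {1..n}" "j \<in> {1..n}" "e i \<noteq> e j" for i j
    using that polar_less[of i j] polar_less[of j i] polar_commute[of T "e i" "e j"]
    by (metis linorder_neqE_nat)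
  have "x * x - T x * x \<in> base_field scl" for x
    by (rule trace_form_of_basis[OF span lin]) (use quad polar in blast)+
  then show ?thesis
    using standard_involution_of_trace_form[OF lin T_F T1]
    by (auto simp: has_standard_involution_def)
qed

end

theorem mainTheorem5:
  fixes scl :: "'a::field \<Rightarrow> 'b::ring_1 \<Rightarrow> 'b"
    and n :: nat
    and e :: "nat \<Rightarrow> 'b"
    and c :: "nat \<Rightarrow> nat \<Rightarrow> nat \<Rightarrow> 'a"
  assumes "unital_algebra scl"
    and "1 \<le> n"
    and "indexed_basis scl n e"
    and "e 1 = 1"
    and "multiplication_table scl n e c"
  shows "standard_involution_test n c \<longleftrightarrow> has_standard_involution scl"
  using unital_algebra.standard_involution_test_sound[OF assms]
    unital_algebra.standard_involution_test_complete[OF assms]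
  by (auto simp: has_standard_involution_def)

end
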